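(* Let $F$ be a Riemannian submersion from a Sasakian manifold $M(\phi,\xi,\eta,g_M)$ onto a Riemannian manifold $(N,g_N)$ such that $\xi\in\Gamma(\ker F_* )$. Then $F$ is a slant Riemannian submersion if and only if there exists a constant $\lambda\in[0,1]$ such that $$\psi^2=-\lambda(I-\eta\otimes\xi)$$ on $\ker F_*$. Furthermore, in such case, if $\theta$ is the slant angle of $F$, then $\lambda=\cos^2\theta$.
   Context: An almost contact metric structure $(\phi,\xi,\eta,g)$ on $M$ consists of a $(1,1)$-tensor field $\phi$, a vector field $\xi$, a 1-form $\eta$ and a Riemannian metric $g$ with $\phi^2=-I+\eta\otimes\xi$, $\phi\xi=0$, $\eta\circ\phi=0$, $\eta(\xi)=1$, $g(\phi X,\phi Y)=g(X,Y)-\eta(X)\eta(Y)$, $\eta(X)=g(X,\xi)$. It is Sasakian if $(\nabla_X\phi)Y=g(X,Y)\xi-\eta(Y)X$ for the Levi-Civita connection $\nabla$ of $g$; then $\nabla_X\xi=-\phi X$. A Riemannian submersion $F:(M,g_M)\to(N,g_N)$ is a smooth surjective map of maximal rank such that $F_*$ preserves lengths of horizontal vectors. Vectors in $\ker F_*$ are vertical, vectors in $(\ker F_* )^\perp$ are horizontal. $F$ is slant if for every nonzero vertical vector $X$ that is not a multiple of $\xi$, the angle $\theta(X)$ between $\phi X$ and the space $\ker F_*$ is a constant $\theta$, independent of the point $p\in M$ and of $X$; $\theta$ is the slant angle. For vertical $U$, write $\phi U=\psi U+\omega U$ with $\psi U$ vertical and $\omega U$ horizontal. *)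

theory Defs
  imports "HOL-Analysis.Analysis" "HOL-Library.Function_Algebras"
begin

section \<open>Pointwise vector space structure on functions\<close>

instantiation "fun" :: (type, real_vector) real_vector
begin

definition scaleR_fun :: "real \<Rightarrow> ('a \<Rightarrow> 'b) \<Rightarrow> 'a \<Rightarrow> 'b"
  where "scaleR_fun a f = (\<lambda>x. a *\<^sub>R f x)"

instance
  by standard
    (simp_all add: scaleR_fun_def plus_fun_def fun_eq_iff scaleR_add_right scaleR_add_left)

end

section \<open>Smooth manifolds\<close>

text \<open>Only used for open \<open>S\<close>.\<close>

primrec differentiable_upto ::
    "nat \<Rightarrow> 'a::real_normed_vector set \<Rightarrow> ('a \<Rightarrow> 'b::real_normed_vector) \<Rightarrow> bool" where
  "differentiable_upto 0 S f \<longleftrightarrow> continuous_on S f"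
| "differentiable_upto (Suc n) S f \<longleftrightarrow>
     (\<forall>x\<in>S. f differentiable (at x)) \<and>
     (\<forall>v. differentiable_upto n S (\<lambda>x. frechet_derivative f (at x) v))"

definition smooth_on ::
    "'a::real_normed_vector set \<Rightarrow> ('a \<Rightarrow> 'b::real_normed_vector) \<Rightarrow> bool" where
  "smooth_on S f \<longleftrightarrow> (\<forall>n. differentiable_upto n S f)"

text \<open>A chart is a domain together with its coordinate map, whose values outside the domain
  are irrelevant. A manifold is a whole (Hausdorff, second countable) type of points together
  with a smooth atlas. The model is an arbitrary finite-dimensional normed space rather than a
  type of class \<open>euclidean_space\<close>, whose instances all have positive dimension, so that
  zero-dimensional manifolds are covered as well.\<close>

type_synonym ('a, 'e) chart = "'a set \<times> ('a \<Rightarrow> 'e)"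

definition chart_inv :: "('a, 'e) chart \<Rightarrow> 'e \<Rightarrow> 'a" where
  "chart_inv c = inv_into (fst c) (snd c)"

definition transition :: "('a, 'e) chart \<Rightarrow> ('a, 'e) chart \<Rightarrow> 'e \<Rightarrow> 'e" where
  "transition c d = snd d \<circ> chart_inv c"

definition smooth_manifold ::
    "('a::{t2_space, second_countable_topology}, 'e::real_normed_vector) chart set \<Rightarrow> bool" where
  "smooth_manifold A \<longleftrightarrow>
     (\<exists>B :: 'e set. finite B \<and> span B = UNIV) \<and>
     (\<Union>c\<in>A. fst c) = UNIV \<and>
     (\<forall>c\<in>A. open (fst c) \<and> open (snd c ` fst c) \<and>
        homeomorphism (fst c) (snd c ` fst c) (snd c) (chart_inv c)) \<and>
     (\<forall>c\<in>A. \<forall>d\<in>A. smooth_on (snd c ` (fst c \<inter> fst d)) (transition c d))"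

definition smooth_function ::
    "('a::topological_space, 'e::real_normed_vector) chart set \<Rightarrow>
     ('a \<Rightarrow> real) \<Rightarrow> bool" where
  "smooth_function A f \<longleftrightarrow> (\<forall>c\<in>A. smooth_on (snd c ` fst c) (f \<circ> chart_inv c))"

definition smooth_map ::
    "('a::topological_space, 'e::real_normed_vector) chart set \<Rightarrow>
     ('b::topological_space, 'f::real_normed_vector) chart set \<Rightarrow> ('a \<Rightarrow> 'b) \<Rightarrow> bool" where
  "smooth_map A B F \<longleftrightarrow> continuous_on UNIV F \<and>
     (\<forall>c\<in>A. \<forall>d\<in>B. smooth_on (snd c ` (fst c \<inter> F -` fst d)) (snd d \<circ> F \<circ> chart_inv c))"

section \<open>Tangent vectors, vector fields and tensor fields\<close>

text \<open>A tangent vector at \<open>p\<close> is the family of its coordinate representations in all charts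
  around \<open>p\<close>, related by the derivatives of the chart transitions. The value \<open>0\<close> at all other
  charts makes the representation unique.\<close>

type_synonym ('a, 'e) tvec = "('a, 'e) chart \<Rightarrow> 'e"

definition tangent_space ::
    "('a, 'e::real_normed_vector) chart set \<Rightarrow> 'a \<Rightarrow> ('a, 'e) tvec set" where
  "tangent_space A p = {v.
     (\<forall>c. c \<notin> A \<or> p \<notin> fst c \<longrightarrow> v c = 0) \<and>
     (\<forall>c\<in>A. \<forall>d\<in>A. p \<in> fst c \<inter> fst d \<longrightarrow>
        v d = frechet_derivative (transition c d) (at (snd c p)) (v c))}"

definition chart_around :: "('a, 'e) chart set \<Rightarrow> 'a \<Rightarrow> ('a, 'e) chart" where
  "chart_around A p = (SOME c. c \<in> A \<and> p \<in> fst c)"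

text \<open>The next two definitions do not depend on the chosen chart around \<open>p\<close> when \<open>f\<close> and \<open>F\<close>
  are smooth.\<close>

definition directional_derivative ::
    "('a, 'e::real_normed_vector) chart set \<Rightarrow> 'a \<Rightarrow> ('a, 'e) tvec \<Rightarrow> ('a \<Rightarrow> real) \<Rightarrow> real" where
  "directional_derivative A p v f =
     (let c = chart_around A p in frechet_derivative (f \<circ> chart_inv c) (at (snd c p)) (v c))"

definition differential ::
    "('a, 'e::real_normed_vector) chart set \<Rightarrow> ('b, 'f::real_normed_vector) chart set \<Rightarrow>
     ('a \<Rightarrow> 'b) \<Rightarrow> 'a \<Rightarrow> ('a, 'e) tvec \<Rightarrow> ('b, 'f) tvec" where
  "differential A B F p v =
     (let c = chart_around A p in
      (\<lambda>d. if d \<in> B \<and> F p \<in> fst d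
          then frechet_derivative (snd d \<circ> F \<circ> chart_inv c) (at (snd c p)) (v c)
          else 0))"

type_synonym ('a, 'e) vfield = "'a \<Rightarrow> ('a, 'e) tvec"

definition vector_fields ::
    "('a, 'e::real_normed_vector) chart set \<Rightarrow> ('a, 'e) vfield set" where
  "vector_fields A = {X. (\<forall>p. X p \<in> tangent_space A p) \<and>
     (\<forall>c\<in>A. smooth_on (snd c ` fst c) (\<lambda>y. X (chart_inv c y) c))}"

definition linear_on_space ::
    "'v::real_vector set \<Rightarrow> ('v \<Rightarrow> 'w::real_vector) \<Rightarrow> bool" where
  "linear_on_space V f \<longleftrightarrow>
     (\<forall>u\<in>V. \<forall>v\<in>V. \<forall>a b. f (a *\<^sub>R u + b *\<^sub>R v) = a *\<^sub>R f u + b *\<^sub>R f v)"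

text \<open>Smoothness of a tensor field is tested on global smooth vector fields.\<close>

definition endo_field ::
    "('a, 'e::real_normed_vector) chart set \<Rightarrow>
     ('a \<Rightarrow> ('a, 'e) tvec \<Rightarrow> ('a, 'e) tvec) \<Rightarrow> bool" where
  "endo_field A \<phi> \<longleftrightarrow>
     (\<forall>p. \<forall>u\<in>tangent_space A p. \<phi> p u \<in> tangent_space A p) \<and>
     (\<forall>p. linear_on_space (tangent_space A p) (\<phi> p)) \<and>
     (\<forall>X\<in>vector_fields A. (\<lambda>p. \<phi> p (X p)) \<in> vector_fields A)"

definition one_form ::
    "('a::topological_space, 'e::real_normed_vector) chart set \<Rightarrow>
     ('a \<Rightarrow> ('a, 'e) tvec \<Rightarrow> real) \<Rightarrow> bool" where
  "one_form A \<eta> \<longleftrightarrow>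
     (\<forall>p. linear_on_space (tangent_space A p) (\<eta> p)) \<and>
     (\<forall>X\<in>vector_fields A. smooth_function A (\<lambda>p. \<eta> p (X p)))"

section \<open>Riemannian metrics and the Levi-Civita connection\<close>

type_synonym ('a, 'e) metric = "'a \<Rightarrow> ('a, 'e) tvec \<Rightarrow> ('a, 'e) tvec \<Rightarrow> real"

definition riemannian_metric ::
    "('a::topological_space, 'e::real_normed_vector) chart set \<Rightarrow>
     ('a, 'e) metric \<Rightarrow> bool" where
  "riemannian_metric A g \<longleftrightarrow>
     (\<forall>p. \<forall>u\<in>tangent_space A p. linear_on_space (tangent_space A p) (g p u)) \<and>
     (\<forall>p. \<forall>u\<in>tangent_space A p. \<forall>v\<in>tangent_space A p. g p u v = g p v u) \<and>
     (\<forall>p. \<forall>u\<in>tangent_space A p. u \<noteq> 0 \<longrightarrow> g p u u > 0) \<and>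
     (\<forall>X\<in>vector_fields A. \<forall>Y\<in>vector_fields A. smooth_function A (\<lambda>p. g p (X p) (Y p)))"

definition riemannian_manifold ::
    "('a::{t2_space, second_countable_topology}, 'e::real_normed_vector) chart set \<Rightarrow>
     ('a, 'e) metric \<Rightarrow> bool" where
  "riemannian_manifold A g \<longleftrightarrow> smooth_manifold A \<and> riemannian_metric A g"

definition affine_connection ::
    "('a::topological_space, 'e::real_normed_vector) chart set \<Rightarrow>
     (('a, 'e) vfield \<Rightarrow> ('a, 'e) vfield \<Rightarrow> ('a, 'e) vfield) \<Rightarrow> bool" where
  "affine_connection A nabla \<longleftrightarrow>
     (\<forall>X\<in>vector_fields A. \<forall>Y\<in>vector_fields A. nabla X Y \<in> vector_fields A) \<and>
     (\<forall>X\<in>vector_fields A. \<forall>Y\<in>vector_fields A. \<forall>Z\<in>vector_fields A.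
        nabla (X + Y) Z = nabla X Z + nabla Y Z \<and>
        nabla X (Y + Z) = nabla X Y + nabla X Z) \<and>
     (\<forall>f. smooth_function A f \<longrightarrow> (\<forall>X\<in>vector_fields A. \<forall>Y\<in>vector_fields A.
        nabla (\<lambda>p. f p *\<^sub>R X p) Y = (\<lambda>p. f p *\<^sub>R nabla X Y p) \<and>
        nabla X (\<lambda>p. f p *\<^sub>R Y p) =
          (\<lambda>p. directional_derivative A p (X p) f *\<^sub>R Y p + f p *\<^sub>R nabla X Y p)))"

text \<open>Torsion-freeness is \<open>\<nabla>\<^sub>X Y - \<nabla>\<^sub>Y X = [X, Y]\<close>, with both sides acting on
  functions.\<close>

definition levi_civita ::
    "('a::topological_space, 'e::real_normed_vector) chart set \<Rightarrow> ('a, 'e) metric \<Rightarrow>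
     (('a, 'e) vfield \<Rightarrow> ('a, 'e) vfield \<Rightarrow> ('a, 'e) vfield) \<Rightarrow> bool" where
  "levi_civita A g nabla \<longleftrightarrow> affine_connection A nabla \<and>
     (\<forall>X\<in>vector_fields A. \<forall>Y\<in>vector_fields A. \<forall>f. smooth_function A f \<longrightarrow>
        (\<forall>p. directional_derivative A p (nabla X Y p - nabla Y X p) f =
           directional_derivative A p (X p) (\<lambda>q. directional_derivative A q (Y q) f) -
           directional_derivative A p (Y p) (\<lambda>q. directional_derivative A q (X q) f))) \<and>
     (\<forall>X\<in>vector_fields A. \<forall>Y\<in>vector_fields A. \<forall>Z\<in>vector_fields A. \<forall>p.
        directional_derivative A p (X p) (\<lambda>q. g q (Y q) (Z q)) =
          g p (nabla X Y p) (Z p) + g p (Y p) (nabla X Z p))"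

section \<open>Almost contact metric and Sasakian structures\<close>

definition almost_contact_metric ::
    "('a::topological_space, 'e::real_normed_vector) chart set \<Rightarrow>
     ('a \<Rightarrow> ('a, 'e) tvec \<Rightarrow> ('a, 'e) tvec) \<Rightarrow> ('a, 'e) vfield \<Rightarrow>
     ('a \<Rightarrow> ('a, 'e) tvec \<Rightarrow> real) \<Rightarrow> ('a, 'e) metric \<Rightarrow> bool" where
  "almost_contact_metric A \<phi> \<xi> \<eta> g \<longleftrightarrow>
     endo_field A \<phi> \<and> \<xi> \<in> vector_fields A \<and> one_form A \<eta> \<and> riemannian_metric A g \<and>
     (\<forall>p. \<phi> p (\<xi> p) = 0 \<and> \<eta> p (\<xi> p) = 1) \<and>
     (\<forall>p. \<forall>u\<in>tangent_space A p.
        \<phi> p (\<phi> p u) = - u + \<eta> p u *\<^sub>R \<xi> p \<and>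
        \<eta> p (\<phi> p u) = 0 \<and>
        \<eta> p u = g p u (\<xi> p)) \<and>
     (\<forall>p. \<forall>u\<in>tangent_space A p. \<forall>v\<in>tangent_space A p.
        g p (\<phi> p u) (\<phi> p v) = g p u v - \<eta> p u * \<eta> p v)"

text \<open>The Levi-Civita connection exists and is unique on smooth vector fields, so the
  existential quantifier merely names it. The last clause expands
  \<open>(\<nabla>\<^sub>X \<phi>) Y = \<nabla>\<^sub>X (\<phi> Y) - \<phi> (\<nabla>\<^sub>X Y)\<close>.\<close>

definition sasakian_manifold ::
    "('a::{t2_space, second_countable_topology}, 'e::real_normed_vector) chart set \<Rightarrow>
     ('a \<Rightarrow> ('a, 'e) tvec \<Rightarrow> ('a, 'e) tvec) \<Rightarrow> ('a, 'e) vfield \<Rightarrow>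
     ('a \<Rightarrow> ('a, 'e) tvec \<Rightarrow> real) \<Rightarrow> ('a, 'e) metric \<Rightarrow> bool" where
  "sasakian_manifold A \<phi> \<xi> \<eta> g \<longleftrightarrow>
     smooth_manifold A \<and> almost_contact_metric A \<phi> \<xi> \<eta> g \<and>
     (\<exists>nabla. levi_civita A g nabla \<and>
        (\<forall>X\<in>vector_fields A. \<forall>Y\<in>vector_fields A. \<forall>p.
           nabla X (\<lambda>q. \<phi> q (Y q)) p - \<phi> p (nabla X Y p) =
             g p (X p) (Y p) *\<^sub>R \<xi> p - \<eta> p (Y p) *\<^sub>R X p))"

section \<open>Slant Riemannian submersions\<close>

definition vertical_space ::
    "('a, 'e::real_normed_vector) chart set \<Rightarrow> ('b, 'f::real_normed_vector) chart set \<Rightarrow>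
     ('a \<Rightarrow> 'b) \<Rightarrow> 'a \<Rightarrow> ('a, 'e) tvec set" where
  "vertical_space M N F p = {v \<in> tangent_space M p. differential M N F p v = 0}"

definition horizontal_space ::
    "('a, 'e::real_normed_vector) chart set \<Rightarrow> ('a, 'e) metric \<Rightarrow>
     ('b, 'f::real_normed_vector) chart set \<Rightarrow> ('a \<Rightarrow> 'b) \<Rightarrow> 'a \<Rightarrow> ('a, 'e) tvec set" where
  "horizontal_space M g N F p =
     {v \<in> tangent_space M p. \<forall>u\<in>vertical_space M N F p. g p v u = 0}"

text \<open>Maximal rank means that every differential is onto. Equality of the squared lengths is
  equality of the lengths.\<close>

definition riemannian_submersion ::
    "('a::topological_space, 'e::real_normed_vector) chart set \<Rightarrow> ('a, 'e) metric \<Rightarrow>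
     ('b::topological_space, 'f::real_normed_vector) chart set \<Rightarrow> ('b, 'f) metric \<Rightarrow>
     ('a \<Rightarrow> 'b) \<Rightarrow> bool" where
  "riemannian_submersion M gM N gN F \<longleftrightarrow>
     smooth_map M N F \<and> surj F \<and>
     (\<forall>p. differential M N F p ` tangent_space M p = tangent_space N (F p)) \<and>
     (\<forall>p. \<forall>v\<in>horizontal_space M gM N F p.
        gN (F p) (differential M N F p v) (differential M N F p v) = gM p v v)"

definition angle_between :: "('v \<Rightarrow> 'v \<Rightarrow> real) \<Rightarrow> 'v \<Rightarrow> 'v \<Rightarrow> real" where
  "angle_between g u v = arccos (g u v / (sqrt (g u u) * sqrt (g v v)))"

definition angle_to_subspace ::
    "('v::zero \<Rightarrow> 'v \<Rightarrow> real) \<Rightarrow> 'v \<Rightarrow> 'v set \<Rightarrow> real" where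
  "angle_to_subspace g v W = (INF w\<in>W - {0}. angle_between g v w)"

text \<open>If \<open>\<xi> p\<close> spans the vertical space at every \<open>p\<close>, the condition is vacuous and every real
  number is a slant angle; otherwise the slant angle is unique.\<close>

definition has_slant_angle ::
    "('a, 'e::real_normed_vector) chart set \<Rightarrow>
     ('a \<Rightarrow> ('a, 'e) tvec \<Rightarrow> ('a, 'e) tvec) \<Rightarrow> ('a, 'e) vfield \<Rightarrow> ('a, 'e) metric \<Rightarrow>
     ('b, 'f::real_normed_vector) chart set \<Rightarrow> ('a \<Rightarrow> 'b) \<Rightarrow> real \<Rightarrow> bool" where
  "has_slant_angle M \<phi> \<xi> g N F \<theta> \<longleftrightarrow>
     (\<forall>p. \<forall>X\<in>vertical_space M N F p. X \<noteq> 0 \<and> X \<notin> span {\<xi> p} \<longrightarrow>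
        angle_to_subspace (g p) (\<phi> p X) (vertical_space M N F p) = \<theta>)"

definition slant_submersion ::
    "('a, 'e::real_normed_vector) chart set \<Rightarrow>
     ('a \<Rightarrow> ('a, 'e) tvec \<Rightarrow> ('a, 'e) tvec) \<Rightarrow> ('a, 'e) vfield \<Rightarrow> ('a, 'e) metric \<Rightarrow>
     ('b, 'f::real_normed_vector) chart set \<Rightarrow> ('a \<Rightarrow> 'b) \<Rightarrow> bool" where
  "slant_submersion M \<phi> \<xi> g N F \<longleftrightarrow> (\<exists>\<theta>. has_slant_angle M \<phi> \<xi> g N F \<theta>)"

text \<open>The vertical component of a tangent vector in the splitting of the tangent space into
  vertical and horizontal vectors.\<close>

definition vertical_part ::
    "('a, 'e::real_normed_vector) chart set \<Rightarrow> ('a, 'e) metric \<Rightarrow>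
     ('b, 'f::real_normed_vector) chart set \<Rightarrow> ('a \<Rightarrow> 'b) \<Rightarrow> 'a \<Rightarrow>
     ('a, 'e) tvec \<Rightarrow> ('a, 'e) tvec" where
  "vertical_part M g N F p v =
     (THE u. u \<in> vertical_space M N F p \<and> v - u \<in> horizontal_space M g N F p)"

definition psi ::
    "('a, 'e::real_normed_vector) chart set \<Rightarrow>
     ('a \<Rightarrow> ('a, 'e) tvec \<Rightarrow> ('a, 'e) tvec) \<Rightarrow> ('a, 'e) metric \<Rightarrow>
     ('b, 'f::real_normed_vector) chart set \<Rightarrow> ('a \<Rightarrow> 'b) \<Rightarrow> 'a \<Rightarrow>
     ('a, 'e) tvec \<Rightarrow> ('a, 'e) tvec" where
  "psi M \<phi> g N F p U = vertical_part M g N F p (\<phi> p U)"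

definition psi_squared_identity ::
    "('a, 'e::real_normed_vector) chart set \<Rightarrow>
     ('a \<Rightarrow> ('a, 'e) tvec \<Rightarrow> ('a, 'e) tvec) \<Rightarrow> ('a, 'e) vfield \<Rightarrow>
     ('a \<Rightarrow> ('a, 'e) tvec \<Rightarrow> real) \<Rightarrow> ('a, 'e) metric \<Rightarrow>
     ('b, 'f::real_normed_vector) chart set \<Rightarrow> ('a \<Rightarrow> 'b) \<Rightarrow> real \<Rightarrow> bool" where
  "psi_squared_identity M \<phi> \<xi> \<eta> g N F l \<longleftrightarrow>
     (\<forall>p. \<forall>U\<in>vertical_space M N F p.
        psi M \<phi> g N F p (psi M \<phi> g N F p U) = - l *\<^sub>R (U - \<eta> p U *\<^sub>R \<xi> p))"

end

theory Submission
  imports Defs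
begin

text \<open>
  The statement is pointwise. The orthogonal projection gives \<open>g (\<phi> X) w = g (\<psi> X) w\<close> for
  vertical \<open>w\<close>, so by Cauchy-Schwarz the angle between \<open>\<phi> X\<close> and the vertical space has cosine
  \<open>\<bar>\<psi> X\<bar> / \<bar>\<phi> X\<bar>\<close>, where \<open>\<bar>\<phi> X\<bar>\<^sup>2 = g X X - (\<eta> X)\<^sup>2\<close>. Hence the slant condition says
  \<open>g (\<psi> X) (\<psi> X) = cos\<^sup>2 \<theta> (g X X - (\<eta> X)\<^sup>2)\<close>. As \<open>\<phi>\<close>, and therefore \<open>\<psi>\<close>, is skew-symmetric,
  polarization turns this into \<open>\<psi>\<^sup>2 = - cos\<^sup>2 \<theta> (I - \<eta> \<otimes> \<xi>)\<close>.
\<close>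

section \<open>Inner products on a subspace: Cauchy-Schwarz and orthogonal projection\<close>

text \<open>The form \<open>g\<close> is constrained only on the carrier \<open>T\<close>, because a
  tangent space is a proper subset of a function type and a metric is arbitrary off it.\<close>

locale inner_product_on =
  fixes T :: "'v::real_vector set" and g :: "'v \<Rightarrow> 'v \<Rightarrow> real"
  assumes subspace_T: "subspace T"
    and linear_g: "u \<in> T \<Longrightarrow> linear_on_space T (g u)"
    and sym: "u \<in> T \<Longrightarrow> v \<in> T \<Longrightarrow> g u v = g v u"
    and pos: "u \<in> T \<Longrightarrow> u \<noteq> 0 \<Longrightarrow> g u u > 0"
begin

lemma T_closed [simp, intro]:
  "0 \<in> T" "u \<in> T \<Longrightarrow> v \<in> T \<Longrightarrow> u + v \<in> T" "u \<in> T \<Longrightarrow> v \<in> T \<Longrightarrow> u - v \<in> T"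
  "u \<in> T \<Longrightarrow> a *\<^sub>R u \<in> T" "u \<in> T \<Longrightarrow> - u \<in> T"
  using subspace_T by (auto simp: subspace_0 subspace_add subspace_diff subspace_scale subspace_neg)

lemma g_comb: "u \<in> T \<Longrightarrow> v \<in> T \<Longrightarrow> w \<in> T \<Longrightarrow> g u (a *\<^sub>R v + b *\<^sub>R w) = a * g u v + b * g u w"
  using linear_g[of u] by (simp add: linear_on_space_def)

lemma g_right:
  assumes "u \<in> T" "v \<in> T"
  shows "w \<in> T \<Longrightarrow> g u (v + w) = g u v + g u w" "w \<in> T \<Longrightarrow> g u (v - w) = g u v - g u w"
    "g u (a *\<^sub>R v) = a * g u v" "g u (- v) = - g u v" "g u 0 = 0"
  using assms g_comb[of u v w 1 1] g_comb[of u v w 1 "-1"] g_comb[of u v v a 0]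
    g_comb[of u v v "-1" 0] g_comb[of u v v 0 0] by simp_all

lemma g_left:
  assumes "u \<in> T" "v \<in> T"
  shows "w \<in> T \<Longrightarrow> g (v + w) u = g v u + g w u" "w \<in> T \<Longrightarrow> g (v - w) u = g v u - g w u"
    "g (a *\<^sub>R v) u = a * g v u" "g (- v) u = - g v u" "g 0 u = 0"
  using assms g_right[OF assms] sym[of _ u] by simp_all

lemma g_self_nonneg: "u \<in> T \<Longrightarrow> 0 \<le> g u u"
  using pos[of u] g_right(5)[of 0 0] by (cases "u = 0") auto

lemma g_self_eq_0_iff: "u \<in> T \<Longrightarrow> g u u = 0 \<longleftrightarrow> u = 0"
  using pos[of u] g_right(5)[of 0 0] by (cases "u = 0") auto

lemma Cauchy_Schwarz:
  assumes u: "u \<in> T" and v: "v \<in> T"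
  shows "\<bar>g u v\<bar> \<le> sqrt (g u u) * sqrt (g v v)"
proof (cases "v = 0")
  case True
  then show ?thesis using u g_right(5)[of u u] by (simp add: g_self_nonneg)
next
  case False
  \<comment> \<open>This is \<open>g v v\<close> times the component of \<open>u\<close> orthogonal
    to \<open>v\<close>; the scaling avoids a division.\<close>
  define w where "w = g v v *\<^sub>R u - g u v *\<^sub>R v"
  have vv: "g v v > 0" using pos v False by simp
  have "0 \<le> g w w" using u v by (simp add: w_def g_self_nonneg)
  also have "g w w = g v v * (g u u * g v v - (g u v)\<^sup>2)"
    using u v by (simp add: w_def g_left g_right sym[of v u] algebra_simps power2_eq_square)
  finally have "(g u v)\<^sup>2 \<le> g u u * g v v"
    using vv by (simp add: zero_le_mult_iff)
  then show ?thesis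
    by (metis real_sqrt_abs real_sqrt_le_mono real_sqrt_mult)
qed

text \<open>Gram-Schmidt, one spanning vector at a time. The vector \<open>v\<close> is kept
  arbitrary so that the induction hypothesis projects both \<open>v\<close> and the new vector
  \<open>b\<close>.\<close>

lemma orthogonal_projection_exists:
  assumes "finite B" "span B \<subseteq> T" "v \<in> T"
  shows "\<exists>u\<in>span B. \<forall>w\<in>span B. g (v - u) w = 0"
  using assms
proof (induction B arbitrary: v rule: finite_induct)
  case empty
  then show ?case using g_right(5)[of v v] by simp
next
  case (insert b B)
  have sub: "span B \<subseteq> span (insert b B)" by (intro span_mono) auto
  have BT: "span B \<subseteq> T" using sub insert.prems by blast
  have bT: "b \<in> T" using insert.prems span_superset by blast
  obtain p where p: "p \<in> span B" "\<forall>w\<in>span B. g (b - p) w = 0"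
    using insert.IH[OF BT bT] by blast
  obtain q where q: "q \<in> span B" "\<forall>w\<in>span B. g (v - q) w = 0"
    using insert.IH[OF BT \<open>v \<in> T\<close>] by blast
  define c where "c = b - p"
  \<comment> \<open>The projection onto \<open>span B\<close> is corrected along \<open>c\<close>,
    the part of \<open>b\<close> orthogonal to \<open>span B\<close>. If \<open>b\<close> already
    lies in \<open>span B\<close>, then \<open>c = 0\<close> and the correction vanishes.\<close>
  define r where "r = q + (g v c / g c c) *\<^sub>R c"
  have pT: "p \<in> T" and qT: "q \<in> T" using p q BT by auto
  have cT: "c \<in> T" using bT pT by (simp add: c_def)
  have c_in: "c \<in> span (insert b B)"
    unfolding c_def using p(1) sub by (intro span_diff) (auto intro: span_base)
  have r_in: "r \<in> span (insert b B)"
    unfolding r_def using q(1) sub c_in by (intro span_add span_scale) auto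
  have "g (v - r) w = 0" if w: "w \<in> span (insert b B)" for w
  proof -
    obtain k where k: "w - k *\<^sub>R b \<in> span B" using w by (auto simp: span_insert)
    \<comment> \<open>Trading \<open>b\<close> for \<open>c\<close> splits \<open>w\<close> into
      \<open>s\<close> in \<open>span B\<close> and a multiple of \<open>c\<close>, which are tested
      separately.\<close>
    define s where "s = (w - k *\<^sub>R b) + k *\<^sub>R p"
    have s: "s \<in> span B" unfolding s_def using k p(1) by (intro span_add span_scale)
    have sT: "s \<in> T" using s BT by auto
    have w_eq: "w = s + k *\<^sub>R c" by (simp add: s_def c_def algebra_simps)
    have cq: "g q c = 0"
      using p(2) q(1) sym[OF qT cT] by (simp add: c_def)
    have "g (v - q) s = 0" "g c s = 0" using q(2) p(2) s by (auto simp: c_def)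
    then have vs: "g (v - r) s = 0"
      using insert.prems(2) qT cT sT by (simp add: r_def g_left)
    have vc: "g (v - r) c = 0"
      using insert.prems(2) qT cT cq g_self_eq_0_iff[OF cT] g_right(5)[of v v]
      by (cases "c = 0") (auto simp: r_def g_left)
    show ?thesis
      using insert.prems(2) qT cT sT vs vc unfolding w_eq
      by (simp add: r_def g_right)
  qed
  then show ?case using r_in by blast
qed

end

section \<open>Linear algebra of the contact structure at a single point\<close>

text \<open>\<open>T\<close> stands for the tangent space and \<open>V\<close> for the vertical
  space at one point; \<open>fin_V\<close> provides the orthogonal projection onto
  \<open>V\<close>.\<close>

locale contact_subspace = inner_product_on T g
  for T :: "'v::real_vector set" and g +
  fixes V :: "'v set" and \<phi> :: "'v \<Rightarrow> 'v" and \<xi> :: 'v and \<eta> :: "'v \<Rightarrow> real"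
  assumes V_sub: "V \<subseteq> T" and subspace_V: "subspace V"
    and fin_V: "\<exists>B. finite B \<and> span B = V"
    and xi_V: "\<xi> \<in> V"
    and phi_T: "u \<in> T \<Longrightarrow> \<phi> u \<in> T"
    and phi_lin: "linear_on_space T \<phi>"
    and phi_xi: "\<phi> \<xi> = 0" and eta_xi: "\<eta> \<xi> = 1"
    and phi_phi: "u \<in> T \<Longrightarrow> \<phi> (\<phi> u) = - u + \<eta> u *\<^sub>R \<xi>"
    and eta_phi: "u \<in> T \<Longrightarrow> \<eta> (\<phi> u) = 0"
    and eta_g: "u \<in> T \<Longrightarrow> \<eta> u = g u \<xi>"
    and g_phi: "u \<in> T \<Longrightarrow> v \<in> T \<Longrightarrow> g (\<phi> u) (\<phi> v) = g u v - \<eta> u * \<eta> v"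
begin

text \<open>The description repeats \<open>vertical_part\<close> with
  \<open>horizontal_space\<close> unfolded, so that \<psi> agrees with \<open>psi\<close> by
  unfolding alone.\<close>

definition proj :: "'v \<Rightarrow> 'v" where
  "proj v = (THE u. u \<in> V \<and> v - u \<in> {w \<in> T. \<forall>u\<in>V. g w u = 0})"

definition \<psi> :: "'v \<Rightarrow> 'v" where "\<psi> u = proj (\<phi> u)"

lemma VT: "v \<in> V \<Longrightarrow> v \<in> T"
  using V_sub by auto

lemma V_closed:
  "u \<in> V \<Longrightarrow> v \<in> V \<Longrightarrow> u + v \<in> V" "u \<in> V \<Longrightarrow> v \<in> V \<Longrightarrow> u - v \<in> V" "u \<in> V \<Longrightarrow> a *\<^sub>R u \<in> V"
  "u \<in> V \<Longrightarrow> - u \<in> V"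
  using subspace_V by (auto simp: subspace_add subspace_diff subspace_scale subspace_neg)

text \<open>Existence is Gram-Schmidt on a finite spanning set of \<open>V\<close>. Two candidates
  differ by a vector of \<open>V\<close> orthogonal to itself, hence by zero.\<close>

lemma proj:
  assumes "v \<in> T"
  shows "proj v \<in> V" "w \<in> V \<Longrightarrow> g (proj v) w = g v w"
proof -
  let ?P = "\<lambda>u. u \<in> V \<and> v - u \<in> {w \<in> T. \<forall>u\<in>V. g w u = 0}"
  obtain B where B: "finite B" "span B = V" using fin_V by blast
  then obtain u where u: "u \<in> V" "\<forall>w\<in>V. g (v - u) w = 0"
    using orthogonal_projection_exists[of B v] V_sub assms by auto
  have "?P (proj v)"
    unfolding proj_def
  proof (rule theI)
    show "?P u" using u assms VT by auto
    fix u' assume u': "?P u'"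
    then have T: "u \<in> T" "u' \<in> T" and d: "u - u' \<in> V" using u VT V_closed by auto
    have "g (u - u') (u - u') = g (v - u') (u - u') - g (v - u) (u - u')"
      using T assms by (simp add: g_left g_right)
    also have "\<dots> = 0" using u u' d by auto
    finally show "u' = u" using T g_self_eq_0_iff[of "u - u'"] by simp
  qed
  then show "proj v \<in> V" "w \<in> V \<Longrightarrow> g (proj v) w = g v w"
    using assms VT[of w] VT[of "proj v"] by (auto simp: g_left)
qed

lemma psi_V: "u \<in> V \<Longrightarrow> \<psi> u \<in> V"
  by (simp add: \<psi>_def proj phi_T VT)

lemma g_psi: "u \<in> V \<Longrightarrow> w \<in> V \<Longrightarrow> g (\<psi> u) w = g (\<phi> u) w"
  by (simp add: \<psi>_def proj phi_T VT)

text \<open>Compatibility of \<phi> with \<open>g\<close>, applied to \<open>\<phi> u\<close> and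
  \<open>v\<close>, introduces \<open>\<phi> (\<phi> u)\<close>; the correction terms vanish because
  \<eta> kills the image of \<phi>.\<close>

lemma phi_skew:
  assumes "u \<in> T" "v \<in> T"
  shows "g (\<phi> u) v = - g u (\<phi> v)"
proof -
  have "g (\<phi> u) v = g (\<phi> (\<phi> u)) (\<phi> v)"
    using assms by (simp add: g_phi phi_T eta_phi)
  also have "\<dots> = - g u (\<phi> v) + \<eta> u * \<eta> (\<phi> v)"
    using assms xi_V by (simp add: phi_phi g_left phi_T VT eta_g sym[of \<xi>] del: uminus_add_conv_diff)
  finally show ?thesis using assms by (simp add: eta_phi)
qed

lemma psi_skew:
  assumes "u \<in> V" "v \<in> V"
  shows "g (\<psi> u) v = - g u (\<psi> v)"
  using assms phi_skew[of u v] g_psi[of u v] g_psi[of v u]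
  by (simp add: VT psi_V phi_T sym[of u])

text \<open>Both sides have the same inner product with every vector of \<open>V\<close>. Additivity
  is what the polarization below relies on.\<close>

lemma psi_add:
  assumes "u \<in> V" "v \<in> V"
  shows "\<psi> (u + v) = \<psi> u + \<psi> v"
proof -
  let ?d = "\<psi> (u + v) - (\<psi> u + \<psi> v)"
  have d: "?d \<in> V" using assms by (intro V_closed psi_V)
  have "\<phi> (u + v) = \<phi> u + \<phi> v"
    using phi_lin assms VT unfolding linear_on_space_def by (metis scaleR_one)
  then have "g ?d w = 0" if "w \<in> V" for w
    using that assms g_psi[of "u + v" w]
    by (simp add: g_left g_psi V_closed psi_V VT phi_T)
  then show ?thesis using d g_self_eq_0_iff[of ?d] VT by auto
qed

lemma phi_norm: "u \<in> T \<Longrightarrow> g (\<phi> u) (\<phi> u) = g u u - (\<eta> u)\<^sup>2"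
  by (simp add: g_phi power2_eq_square)

text \<open>The vectors exempt from the slant condition are thus exactly those whose image under
  \<phi> is zero, where no angle is defined.\<close>

lemma phi_eq_0_iff:
  assumes "u \<in> T"
  shows "\<phi> u = 0 \<longleftrightarrow> u \<in> span {\<xi>}"
proof
  assume "\<phi> u = 0"
  moreover have "\<phi> 0 = 0"
    using phi_lin T_closed(1) unfolding linear_on_space_def by (metis scaleR_zero_left add_0)
  ultimately have "u = \<eta> u *\<^sub>R \<xi>" using phi_phi[OF assms] by simp
  then show "u \<in> span {\<xi>}" by (metis span_base span_scale singletonI)
next
  assume "u \<in> span {\<xi>}"
  then obtain k where "u = k *\<^sub>R \<xi>" by (auto simp: span_singleton)
  then show "\<phi> u = 0"
    using phi_lin xi_V VT phi_xi unfolding linear_on_space_def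
    by (metis scaleR_zero_right scaleR_zero_left add_0_right)
qed

text \<open>The infimum is a minimum: Cauchy-Schwarz applied to \<open>\<psi> X\<close> and
  \<open>w\<close> bounds every cosine by the quotient, and \<open>w = \<psi> X\<close> attains
  it.\<close>

lemma angle_to_V:
  assumes X: "X \<in> V" and nX: "X \<notin> span {\<xi>}"
  shows "angle_to_subspace g (\<phi> X) V = arccos (sqrt (g (\<psi> X) (\<psi> X)) / sqrt (g (\<phi> X) (\<phi> X)))"
    (is "_ = arccos (?n / ?m)")
    and "sqrt (g (\<psi> X) (\<psi> X)) / sqrt (g (\<phi> X) (\<phi> X)) \<in> {0..1}"
proof -
  have T: "X \<in> T" "\<phi> X \<in> T" "\<psi> X \<in> V" "\<psi> X \<in> T" using X VT phi_T psi_V by auto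
  have m: "?m > 0" using T nX phi_eq_0_iff pos by simp
  have n: "?n \<ge> 0" using T by (simp add: g_self_nonneg)
  have nsq: "?n * ?n = g (\<psi> X) (\<psi> X)" using T by (simp add: g_self_nonneg)
  have le: "?n * ?n \<le> ?m * ?n"
    using Cauchy_Schwarz[OF T(2,4)] g_psi[OF X T(3)] nsq by simp
  have "?n \<le> ?m"
    using mult_right_le_imp_le[OF le] n m by linarith
  then show range: "?n / ?m \<in> {0..1}" using n m by simp
  have upper: "arccos (?n / ?m) \<le> angle_between g (\<phi> X) w" if w: "w \<in> V - {0}" for w
  proof -
    have wT: "w \<in> T" and wpos: "sqrt (g w w) > 0" using w VT pos by auto
    have prod: "?m * sqrt (g w w) > 0" using m wpos by simp
    have "g (\<phi> X) w \<le> ?n * sqrt (g w w)"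
      using Cauchy_Schwarz[OF T(4) wT] g_psi[OF X, of w] w by simp
    then have le: "g (\<phi> X) w / (?m * sqrt (g w w)) \<le> ?n / ?m"
      using m wpos by (simp add: field_simps)
    \<comment> \<open>Monotonicity of \<open>arccos\<close> holds only on [-1, 1], so the smaller
      cosine also needs a lower bound.\<close>
    have "- (?m * sqrt (g w w)) \<le> g (\<phi> X) w"
      using Cauchy_Schwarz[OF T(2) wT] by simp
    then have ge: "-1 \<le> g (\<phi> X) w / (?m * sqrt (g w w))"
      using prod by (simp add: pos_le_divide_eq)
    show ?thesis
      unfolding angle_between_def using le ge range by (intro arccos_le_arccos) auto
  qed
  have "\<exists>w\<in>V - {0}. angle_between g (\<phi> X) w = arccos (?n / ?m)"
  proof (cases "\<psi> X = 0")
    \<comment> \<open>Here \<open>\<phi> X\<close> is orthogonal to all of \<open>V\<close>, so any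
      nonzero vertical vector is a minimizer; \<open>X\<close> itself is at hand.\<close>
    case True
    then have "g (\<phi> X) X = 0" "g (\<psi> X) (\<psi> X) = 0"
      using g_psi[OF X X] g_left(5)[of X X] g_left(5)[of 0 0] T by auto
    moreover have "X \<noteq> 0" using nX span_zero by blast
    ultimately show ?thesis using X by (intro bexI[of _ X]) (auto simp: angle_between_def)
  next
    case False
    then have "?n > 0" using pos T by simp
    then have "g (\<phi> X) (\<psi> X) / (?m * ?n) = ?n / ?m"
      using g_psi[OF X T(3)] nsq m by (simp add: field_simps)
    then show ?thesis using False T by (intro bexI[of _ "\<psi> X"]) (auto simp: angle_between_def)
  qed
  then show "angle_to_subspace g (\<phi> X) V = arccos (?n / ?m)"
    unfolding angle_to_subspace_def using upper by (intro cInf_eq_minimum) force+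
qed

lemma angle_eq_iff:
  assumes X: "X \<in> V" "X \<notin> span {\<xi>}"
  shows "angle_to_subspace g (\<phi> X) V = \<theta> \<Longrightarrow>
      g (\<psi> X) (\<psi> X) = (cos \<theta>)\<^sup>2 * (g X X - (\<eta> X)\<^sup>2)"
    and "0 \<le> l \<Longrightarrow> g (\<psi> X) (\<psi> X) = l * (g X X - (\<eta> X)\<^sup>2) \<Longrightarrow>
      angle_to_subspace g (\<phi> X) V = arccos (sqrt l)"
proof -
  let ?n = "g (\<psi> X) (\<psi> X)" and ?m = "g (\<phi> X) (\<phi> X)"
  have T: "X \<in> T" "\<phi> X \<in> T" "\<psi> X \<in> T" using X VT phi_T psi_V by auto
  have m: "?m > 0" using T X phi_eq_0_iff pos by simp
  have n: "?n \<ge> 0" using T by (simp add: g_self_nonneg)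
  note angle = angle_to_V[OF X]
  {
    assume "angle_to_subspace g (\<phi> X) V = \<theta>"
    \<comment> \<open>The quotient lies in [0, 1], so \<open>cos\<close> undoes
      \<open>arccos\<close>.\<close>
    then have "cos \<theta> = sqrt ?n / sqrt ?m" using angle by auto
    then show "?n = (cos \<theta>)\<^sup>2 * (g X X - (\<eta> X)\<^sup>2)"
      using m n phi_norm[OF T(1)] by (simp add: power_divide)
  next
    assume "0 \<le> l" "?n = l * (g X X - (\<eta> X)\<^sup>2)"
    then have "sqrt ?n / sqrt ?m = sqrt l"
      using m phi_norm[OF T(1)] by (simp add: real_sqrt_mult)
    then show "angle_to_subspace g (\<phi> X) V = arccos (sqrt l)" using angle by simp
  }
qed

text \<open>On the exempt vectors both sides of the norm identity vanish, so the identity extends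
  from the slant condition to all of \<open>V\<close>.\<close>

lemma psi_norm_span_xi:
  assumes "X \<in> V" "X \<in> span {\<xi>}"
  shows "g (\<psi> X) (\<psi> X) = 0" "g X X - (\<eta> X)\<^sup>2 = 0"
proof -
  have "\<phi> X = 0" using assms phi_eq_0_iff VT by simp
  then show "g X X - (\<eta> X)\<^sup>2 = 0" "g (\<psi> X) (\<psi> X) = 0"
    using assms phi_norm[of X] g_psi[of X "\<psi> X"] g_left(5)[of _ 0] psi_V VT by auto
qed

text \<open>Skew-symmetry turns \<open>g (\<psi> U) (\<psi> U)\<close> into
  \<open>- g (\<psi> (\<psi> U)) U\<close>. The converse polarizes this quadratic identity and uses
  that \<open>g\<close> is nondegenerate on \<open>V\<close>.\<close>

lemma psi_square_iff:
  "(\<forall>U\<in>V. \<psi> (\<psi> U) = - l *\<^sub>R (U - \<eta> U *\<^sub>R \<xi>)) \<longleftrightarrow>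
   (\<forall>U\<in>V. g (\<psi> U) (\<psi> U) = l * (g U U - (\<eta> U)\<^sup>2))" (is "?L \<longleftrightarrow> ?R")
proof
  assume L: ?L
  show ?R
  proof
    fix U assume U: "U \<in> V"
    have "g (\<psi> U) (\<psi> U) = - g (\<psi> (\<psi> U)) U"
      using psi_skew[of "\<psi> U" U] U psi_V by simp
    also have "\<dots> = l * (g U U - (\<eta> U)\<^sup>2)"
      using L U xi_V VT
      by (simp add: g_left eta_g sym[of \<xi>] power2_eq_square)
    finally show "g (\<psi> U) (\<psi> U) = l * (g U U - (\<eta> U)\<^sup>2)" .
  qed
next
  assume R: ?R
  \<comment> \<open>Polarization: the norm identity at \<open>U + W\<close> minus those at
    \<open>U\<close> and \<open>W\<close> is twice the claim.\<close>
  have bilinear: "g (\<psi> U) (\<psi> W) = l * (g U W - \<eta> U * \<eta> W)" if U: "U \<in> V" and W: "W \<in> V" for U W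
  proof -
    note T = U W xi_V psi_V[OF U] psi_V[OF W]
    have "g (\<psi> (U + W)) (\<psi> (U + W)) = l * (g (U + W) (U + W) - (\<eta> (U + W))\<^sup>2)"
      using R U W V_closed by blast
    moreover have "g (\<psi> U) (\<psi> U) = l * (g U U - (\<eta> U)\<^sup>2)" "g (\<psi> W) (\<psi> W) = l * (g W W - (\<eta> W)\<^sup>2)"
      using R U W by auto
    moreover have "\<eta> (U + W) = \<eta> U + \<eta> W" using T[THEN VT] by (simp add: eta_g g_left)
    ultimately show ?thesis
      using T[THEN VT] psi_add[OF U W] sym[of "\<psi> W" "\<psi> U"] sym[of W U]
      by (simp add: g_left g_right power2_eq_square algebra_simps)
  qed
  show ?L
  proof
    fix U assume U: "U \<in> V"
    let ?d = "\<psi> (\<psi> U) + l *\<^sub>R (U - \<eta> U *\<^sub>R \<xi>)"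
    have d: "?d \<in> V" using U xi_V by (intro V_closed psi_V)
    have "g ?d W = 0" if W: "W \<in> V" for W
    proof -
      have "g (\<psi> (\<psi> U)) W = - g (\<psi> U) (\<psi> W)" using psi_skew U W psi_V by simp
      then show ?thesis
        using bilinear[OF U W] U W xi_V VT psi_V
        by (simp add: g_left eta_g sym[of \<xi>])
    qed
    then have "?d = 0" using d g_self_eq_0_iff[of ?d] VT by auto
    then show "\<psi> (\<psi> U) = - l *\<^sub>R (U - \<eta> U *\<^sub>R \<xi>)" by (simp add: eq_neg_iff_add_eq_0)
  qed
qed

end

section \<open>Tangent and vertical spaces as finite-dimensional subspaces\<close>

lemma smooth_on_differentiable: "smooth_on S f \<Longrightarrow> x \<in> S \<Longrightarrow> f differentiable (at x)"
  unfolding smooth_on_def by (metis differentiable_upto.simps(2))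

lemma linear_transition_derivative:
  assumes "smooth_manifold A" "c \<in> A" "d \<in> A" "p \<in> fst c \<inter> fst d"
  shows "linear (frechet_derivative (transition c d) (at (snd c p)))"
  using assms unfolding smooth_manifold_def
  by (intro linear_frechet_derivative smooth_on_differentiable[of "snd c ` (fst c \<inter> fst d)"]) auto

text \<open>The reversed equation makes a terminating rewrite rule, unlike the one in the
  definition.\<close>

lemma tangent_space_iff:
  "v \<in> tangent_space A p \<longleftrightarrow>
     (\<forall>c. c \<notin> A \<or> p \<notin> fst c \<longrightarrow> v c = 0) \<and>
     (\<forall>c\<in>A. \<forall>d\<in>A. p \<in> fst c \<inter> fst d \<longrightarrow>
        frechet_derivative (transition c d) (at (snd c p)) (v c) = v d)"
  by (simp only: tangent_space_def mem_Collect_eq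
      eq_commute[of "v d" "frechet_derivative f F x" for d f F x])

lemma subspace_tangent_space:
  assumes "smooth_manifold A"
  shows "subspace (tangent_space A p)"
  unfolding subspace_def using linear_transition_derivative[OF assms, of _ _ p]
  by (auto simp: tangent_space_iff scaleR_fun_def linear_0 linear_add linear_scale)

lemma chart_around:
  assumes "smooth_manifold A"
  shows "chart_around A p \<in> A" "p \<in> fst (chart_around A p)"
proof -
  have "p \<in> (\<Union>c\<in>A. fst c)" using assms by (auto simp: smooth_manifold_def)
  then have "\<exists>c. c \<in> A \<and> p \<in> fst c" by blast
  from someI_ex[OF this] show "chart_around A p \<in> A" "p \<in> fst (chart_around A p)"
    by (simp_all add: chart_around_def)
qed

text \<open>Evaluation in a chart around \<open>p\<close> embeds the tangent space into the model space.\<close>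

lemma tangent_subspace_finite_span:
  fixes A :: "('a::{t2_space, second_countable_topology}, 'e::real_normed_vector) chart set"
  assumes A: "smooth_manifold A" and V: "subspace V" "V \<subseteq> tangent_space A p"
  shows "\<exists>B. finite B \<and> span B = V"
proof -
  define c where "c = chart_around A p"
  have c: "c \<in> A" "p \<in> fst c" using chart_around[OF A] by (auto simp: c_def)
  obtain E :: "'e set" where E: "finite E" "span E = UNIV" using A by (auto simp: smooth_manifold_def)
  obtain B where B: "B \<subseteq> V" "independent B" "V \<subseteq> span B"
    by (rule basis_exists)
  have span: "span B = V" using B V(1) span_minimal by blast
  let ?ev = "\<lambda>v :: ('a, 'e) tvec. v c"
  have lin: "linear ?ev" by (rule linearI) (simp_all add: scaleR_fun_def)
  \<comment> \<open>The value in chart \<open>c\<close> determines those in all other charts around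
    \<open>p\<close> through the transition derivatives; the remaining values are zero.\<close>
  have inj: "inj_on ?ev V"
  proof (rule inj_onI)
    fix u v assume uv: "u \<in> V" "v \<in> V" "u c = v c"
    have "u d = v d" for d
    proof (cases "d \<in> A \<and> p \<in> fst d")
      case True
      then have "frechet_derivative (transition c d) (at (snd c p)) (w c) = w d" if "w \<in> V" for w
        using that V(2) c by (force simp: tangent_space_iff)
      then show ?thesis using uv by metis
    next
      case False
      then have "u d = 0" "v d = 0" using uv(1,2)[THEN subsetD[OF V(2)]]
        by (simp_all add: tangent_space_iff del: split_paired_All)
      then show ?thesis by simp
    qed
    then show "u = v" by (rule ext)
  qed
  have "independent (?ev ` B)"
    using linear_independent_injective_image[OF lin B(2)] inj span by simp
  then have "finite (?ev ` B)" using independent_span_bound[OF E(1)] E(2) by auto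
  moreover have "inj_on ?ev B" using inj B(1) inj_on_subset by blast
  ultimately show ?thesis using span finite_image_iff by blast
qed

text \<open>With the source chart fixed by \<open>chart_around\<close>, the differential is a linear
  map in each target chart around \<open>F p\<close>, and its kernel is cut out of the tangent
  space.\<close>

lemma subspace_vertical_space:
  assumes M: "smooth_manifold M" and N: "smooth_manifold N" and F: "smooth_map M N F"
  shows "subspace (vertical_space M N F p)"
proof -
  define c where "c = chart_around M p"
  have c: "c \<in> M" "p \<in> fst c" using chart_around[OF M] by (auto simp: c_def)
  have "linear (frechet_derivative (snd d \<circ> F \<circ> chart_inv c) (at (snd c p)))"
    if "d \<in> N" "F p \<in> fst d" for d
    using F c that unfolding smooth_map_def
    by (intro linear_frechet_derivative
        smooth_on_differentiable[of "snd c ` (fst c \<inter> F -` fst d)"]) auto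
  then have "subspace {v. differential M N F p v = 0}"
    unfolding subspace_def differential_def Let_def c_def[symmetric] fun_eq_iff
    by (auto simp: scaleR_fun_def linear_0 linear_add linear_scale)
  then have "subspace (tangent_space M p \<inter> {v. differential M N F p v = 0})"
    using subspace_tangent_space[OF M] by (intro subspace_inter)
  then show ?thesis by (simp add: vertical_space_def Int_def)
qed

text \<open>If \<xi> spans every vertical space, each real number is a slant angle and each
  \<open>l\<close> satisfies the identity. The equation \<open>l = (cos \<theta>)\<^sup>2\<close> is
  therefore claimed only given a vertical vector off the line of \<xi>; that
  \<open>(cos \<theta>)\<^sup>2\<close> satisfies the identity is claimed always.\<close>

theorem theorem3:
  fixes M :: "('a::{t2_space, second_countable_topology}, 'e::real_normed_vector) chart set"
    and N :: "('b::{t2_space, second_countable_topology}, 'f::real_normed_vector) chart set"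
    and \<phi> :: "'a \<Rightarrow> ('a, 'e) tvec \<Rightarrow> ('a, 'e) tvec"
    and \<xi> :: "('a, 'e) vfield"
    and \<eta> :: "'a \<Rightarrow> ('a, 'e) tvec \<Rightarrow> real"
    and gM :: "('a, 'e) metric"
    and gN :: "('b, 'f) metric"
    and F :: "'a \<Rightarrow> 'b"
  assumes "sasakian_manifold M \<phi> \<xi> \<eta> gM"
    and "riemannian_manifold N gN"
    and "riemannian_submersion M gM N gN F"
    and "\<forall>p. \<xi> p \<in> vertical_space M N F p"
  shows "(slant_submersion M \<phi> \<xi> gM N F \<longleftrightarrow>
            (\<exists>l\<in>{0..1}. psi_squared_identity M \<phi> \<xi> \<eta> gM N F l)) \<and>
         (\<forall>\<theta>. has_slant_angle M \<phi> \<xi> gM N F \<theta> \<longrightarrow>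
            psi_squared_identity M \<phi> \<xi> \<eta> gM N F ((cos \<theta>)\<^sup>2) \<and>
            ((\<exists>p. \<exists>X\<in>vertical_space M N F p. X \<notin> span {\<xi> p}) \<longrightarrow>
              (\<forall>l\<in>{0..1}. psi_squared_identity M \<phi> \<xi> \<eta> gM N F l \<longrightarrow> l = (cos \<theta>)\<^sup>2)))"
proof -
  let ?V = "vertical_space M N F"
  let ?\<psi> = "psi M \<phi> gM N F"
  have M: "smooth_manifold M" and acm: "almost_contact_metric M \<phi> \<xi> \<eta> gM"
    using assms(1) by (auto simp: sasakian_manifold_def)
  have N: "smooth_manifold N" using assms(2) by (simp add: riemannian_manifold_def)
  have F: "smooth_map M N F" using assms(3) by (simp add: riemannian_submersion_def)
  have sub: "?V p \<subseteq> tangent_space M p" for p by (auto simp: vertical_space_def)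
  interpret inner_product_on "tangent_space M p" "gM p" for p
    using acm subspace_tangent_space[OF M, of p]
    by unfold_locales (auto simp: almost_contact_metric_def riemannian_metric_def)
  interpret contact_subspace "tangent_space M p" "gM p" "?V p" "\<phi> p" "\<xi> p" "\<eta> p" for p
    using acm assms(4) sub[of p] subspace_vertical_space[OF M N F, of p]
      tangent_subspace_finite_span[OF M subspace_vertical_space[OF M N F] sub, of p]
    unfolding almost_contact_metric_def endo_field_def by unfold_locales blast+
  have psi_eq: "?\<psi> p = \<psi> p" for p
    by (rule ext) (simp add: psi_def vertical_part_def horizontal_space_def \<psi>_def proj_def)
  have identity_iff: "psi_squared_identity M \<phi> \<xi> \<eta> gM N F l \<longleftrightarrow>
      (\<forall>p. \<forall>X\<in>?V p. gM p (?\<psi> p X) (?\<psi> p X) = l * (gM p X X - (\<eta> p X)\<^sup>2))" for l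
    unfolding psi_squared_identity_def psi_eq psi_square_iff ..
  have slant_imp: "psi_squared_identity M \<phi> \<xi> \<eta> gM N F ((cos \<theta>)\<^sup>2)"
    if slant: "has_slant_angle M \<phi> \<xi> gM N F \<theta>" for \<theta>
    unfolding identity_iff
  proof (intro allI ballI)
    fix p X assume X: "X \<in> ?V p"
    show "gM p (?\<psi> p X) (?\<psi> p X) = (cos \<theta>)\<^sup>2 * (gM p X X - (\<eta> p X)\<^sup>2)"
    proof (cases "X \<in> span {\<xi> p}")
      case True
      then show ?thesis using psi_norm_span_xi[OF X] by (simp add: psi_eq)
    next
      case False
      then have "X \<noteq> 0" using span_zero by blast
      then show ?thesis
        using slant X False angle_eq_iff(1)[OF X False] by (simp add: has_slant_angle_def psi_eq)
    qed
  qed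
  have identity_imp: "has_slant_angle M \<phi> \<xi> gM N F (arccos (sqrt l))"
    if "l \<in> {0..1}" "psi_squared_identity M \<phi> \<xi> \<eta> gM N F l" for l
    using that angle_eq_iff(2) unfolding identity_iff psi_eq has_slant_angle_def by auto
  have unique: "l = k"
    if "psi_squared_identity M \<phi> \<xi> \<eta> gM N F l" "psi_squared_identity M \<phi> \<xi> \<eta> gM N F k"
      and X: "X \<in> ?V p" "X \<notin> span {\<xi> p}" for l k p X
  proof -
    have "l * (gM p X X - (\<eta> p X)\<^sup>2) = k * (gM p X X - (\<eta> p X)\<^sup>2)"
      using that unfolding identity_iff by metis
    \<comment> \<open>This number is the squared length of \<open>\<phi> p X\<close>, which is
      nonzero off the line of \<xi>.\<close>
    moreover have "gM p X X - (\<eta> p X)\<^sup>2 \<noteq> 0"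
      using X VT phi_T phi_eq_0_iff g_self_eq_0_iff phi_norm by metis
    ultimately show ?thesis by simp
  qed
  \<comment> \<open>A slant angle supplies \<open>(cos \<theta>)\<^sup>2\<close> as the constant in
    the forward direction.\<close>
  have "(cos \<theta>)\<^sup>2 \<in> {0..1}" for \<theta> :: real
    by (simp add: abs_square_le_1)
  then show ?thesis
    using slant_imp identity_imp unique unfolding slant_submersion_def by blast
qed

end
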